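(* Let $G$ be a finite, simple, connected graph with at least one edge, on vertex set $\{1,\dots,N\}$, let $\nabla_G=\{\pm(\mathbf e_i-\mathbf e_j)\mid \{i,j\}\in\mathcal E(G)\}\subset\mathbb R^N$, and let $F$ be a facet of $\nabla_G$. Then for every cycle $O$ in $G$ and every coherent orientation $\vec O$ of it, $$|\mathcal E(\vec G_F)\cap\mathcal E(\vec O)|=|\mathcal E(\vec G_F)\cap\mathcal E(-\vec O)|.$$
   Context: $\mathbf e_1,\dots,\mathbf e_N$ is the standard basis of $\mathbb R^N$. A subset $F\subseteq\nabla_G$ is a facet of $\nabla_G$ if $F=\nabla_G\cap P'$ for a facet $P'$ of the polytope $\operatorname{conv}(\nabla_G)$. $\vec G_F$ is the directed graph with edge set $\{(i,j)\mid \mathbf e_i-\mathbf e_j\in F\}$. A coherent orientation $\vec O$ of a cycle $O$ assigns directions to its edges so that no vertex is the tail of two edges or the head of two edges (i.e. the cycle is traversed in one direction); $-\vec O$ is the cycle with all edge directions reversed. Directed edges are compared as ordered pairs, so $\mathcal E(\vec G_F)\cap\mathcal E(\vec O)$ is the set of directed edges of $\vec G_F$ that lie on $O$ with the direction of $\vec O$. *)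

theory Defs
  imports "HOL-Analysis.Analysis" "Graph_Theory.Graph_Theory"
begin

text \<open>
  Simple graphs are the \<^locale>\<open>pair_graph\<close>s of the library: finite loopless digraphs with a
  symmetric set of arcs, so the undirected edge \<open>{i, j}\<close> is the pair of arcs \<open>(i, j)\<close>, \<open>(j, i)\<close>.
  The vertex set \<open>{1, \<dots>, N}\<close> is the whole of a finite type \<open>'n\<close>, which also
  indexes the coordinates of the ambient space \<open>real ^ 'n\<close>.
\<close>

definition nabla :: "'n::finite pair_pre_digraph \<Rightarrow> (real ^ 'n) set" where
  "nabla G = {v. \<exists>i j. (i, j) \<in> parcs G \<and>
                  (v = axis i 1 - axis j 1 \<or> v = - (axis i 1 - axis j 1))}"

definition nabla_facet :: "'n::finite pair_pre_digraph \<Rightarrow> (real ^ 'n) set \<Rightarrow> bool" where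
  "nabla_facet G F \<longleftrightarrow> (\<exists>P. P facet_of (convex hull (nabla G)) \<and> F = nabla G \<inter> P)"

definition facet_digraph :: "(real ^ 'n::finite) set \<Rightarrow> 'n pair_pre_digraph" where
  "facet_digraph F = \<lparr> pverts = UNIV, parcs = {(i, j). axis i 1 - axis j 1 \<in> F} \<rparr>"

text \<open>
  A cycle of \<open>G\<close> is an undirected subgraph, again represented with a symmetric set of
  arcs, whose edges are those of a closed walk without repeated vertices.  The library's
  \<^const>\<open>pre_digraph.cycle\<close> admits the walk \<open>a, b, a\<close> in a symmetric digraph, which
  is not a cycle of the undirected graph; hence the bound on the length.
\<close>

definition undirected_cycle :: "'a pair_pre_digraph \<Rightarrow> 'a pair_pre_digraph \<Rightarrow> bool" where
  "undirected_cycle G C \<longleftrightarrow>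
     (\<exists>p. pre_digraph.cycle (with_proj G) p \<and> 3 \<le> length p \<and>
          pverts C = fst ` set p \<and> parcs C = set p \<union> (set p)\<inverse>)"

definition orientation_of :: "'a pair_pre_digraph \<Rightarrow> 'a pair_pre_digraph \<Rightarrow> bool" where
  "orientation_of D H \<longleftrightarrow>
     pverts D = pverts H \<and> parcs D \<union> (parcs D)\<inverse> = parcs H \<and> parcs D \<inter> (parcs D)\<inverse> = {}"

definition coherent_orientation :: "'a pair_pre_digraph \<Rightarrow> 'a pair_pre_digraph \<Rightarrow> bool" where
  "coherent_orientation D C \<longleftrightarrow>
     orientation_of D C \<and> inj_on fst (parcs D) \<and> inj_on snd (parcs D)"

definition reverse_digraph :: "'a pair_pre_digraph \<Rightarrow> 'a pair_pre_digraph" where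
  "reverse_digraph D = \<lparr> pverts = pverts D, parcs = (parcs D)\<inverse> \<rparr>"

end

theory Submission
  imports Defs
begin

text \<open>
  A facet of the centrally symmetric polytope \<open>conv (nabla G)\<close> lies in a hyperplane
  \<open>a \<bullet> x = 1\<close> that supports the polytope, and the vectors in the facet span the whole polytope.
  Read \<open>a\<close> as a potential on the vertices: an arc \<open>(i, j)\<close> has potential drop
  \<open>a $ i - a $ j\<close> in \<open>[-1, 1]\<close>, and it is an arc of the facet digraph iff the drop is 1.
  Spanning forces all drops to be integers, hence \<open>-1\<close>, \<open>0\<close> or \<open>1\<close>; since the drops
  along a coherently oriented cycle add up to 0, there are as many \<open>1\<close>s as \<open>-1\<close>s.
\<close>

section \<open>Supporting functionals of facets and integrality of the potential\<close>

text \<open>Symmetry puts 0 into the hull but off the supporting hyperplane. Adding 0 to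
  \<open>P\<close> therefore makes up for the one dimension that a facet lacks, so \<open>P\<close>
  has the same linear span as the hull.\<close>

lemma facet_of_symmetric_hull:
  fixes V :: "'a::euclidean_space set"
  assumes "finite V" and sym: "\<And>v. v \<in> V \<Longrightarrow> - v \<in> V"
    and P: "P facet_of convex hull V"
  obtains a where "\<And>v. v \<in> V \<Longrightarrow> a \<bullet> v \<le> 1"
    and "V \<inter> P = {v \<in> V. a \<bullet> v = 1}"
    and "V \<subseteq> span (V \<inter> P)"
proof -
  let ?K = "convex hull V"
  have face: "P face_of ?K" and "P \<noteq> {}" and dimP: "aff_dim P = aff_dim ?K - 1"
    using P by (auto simp: facet_of_def)
  obtain c b where "?K \<subseteq> {x. c \<bullet> x \<le> b}" and Peq: "P = ?K \<inter> {x. c \<bullet> x = b}"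
    using face exposed_face_of_polyhedron[OF polyhedron_convex_hull[OF \<open>finite V\<close>], of P]
    unfolding exposed_face_of_def by blast
  then have le: "c \<bullet> v \<le> b" if "v \<in> V" for v
    using that hull_inc[of v V convex] by auto
  have abs_le: "\<bar>c \<bullet> v\<bar> \<le> b" if "v \<in> V" for v
    using le[OF that] le[OF sym[OF that]] by (simp add: abs_le_iff)
  obtain v\<^sub>0 where v\<^sub>0: "v\<^sub>0 \<in> V"
    using \<open>P \<noteq> {}\<close> Peq by fastforce
  \<comment> \<open>With \<open>b = 0\<close>, symmetry would push all of \<open>V\<close> into the
    hyperplane, so \<open>P\<close> would be the whole hull and have too large a dimension.\<close>
  have "b \<noteq> 0"
  proof
    assume "b = 0"
    then have "V \<subseteq> {x. c \<bullet> x = 0}"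
      using abs_le by fastforce
    then have "?K \<subseteq> {x. c \<bullet> x = 0}"
      by (simp add: convex_hyperplane subset_hull)
    then have "P = ?K"
      using Peq \<open>b = 0\<close> by auto
    with dimP show False by simp
  qed
  with abs_le[OF v\<^sub>0] have "b > 0" by linarith
  have "0 \<in> ?K"
  proof -
    have "(1/2) *\<^sub>R v\<^sub>0 + (1/2) *\<^sub>R (- v\<^sub>0) \<in> ?K"
      using v\<^sub>0 sym by (intro convexD[OF convex_convex_hull]) (auto intro: hull_inc)
    then show ?thesis by simp
  qed
  then have "aff_dim ?K = int (dim ?K)"
    using convex_hull_subset_affine_hull[of V] by (intro aff_dim_zero) auto
  have "affine hull P \<subseteq> {x. c \<bullet> x = b}"
    by (rule hull_minimal) (use Peq affine_hyperplane in auto)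
  then have "0 \<notin> affine hull P"
    using \<open>b > 0\<close> by auto
  then have "aff_dim (insert 0 P) = aff_dim ?K"
    using dimP by (simp add: aff_dim_insert)
  moreover have "aff_dim (insert 0 P) = int (dim P)"
    by (subst aff_dim_zero) (auto intro: hull_inc simp: dim_insert span_zero)
  ultimately have "dim P = dim ?K"
    using \<open>aff_dim ?K = int (dim ?K)\<close> by simp
  then have "span P = span ?K"
    using Peq by (intro dim_eq_span) auto
  \<comment> \<open>A face of a polytope is the hull of the generators it contains, so the
    generators in \<open>P\<close> already span it.\<close>
  moreover obtain W where "W \<subseteq> V" "P = convex hull W"
    using face_of_convex_hull_subset[OF finite_imp_compact[OF \<open>finite V\<close>] face] by blast
  then have "P \<subseteq> span (V \<inter> P)"
    using hull_subset[of W convex] convex_hull_subset_span[of W] span_mono[of W "V \<inter> P"] by blast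
  then have "span P \<subseteq> span (V \<inter> P)"
    by (simp add: span_minimal)
  ultimately have "V \<subseteq> span (V \<inter> P)"
    using hull_subset[of V convex] span_superset[of ?K] by blast
  \<comment> \<open>Dividing by \<open>b > 0\<close> normalises the level of the hyperplane to
    1.\<close>
  moreover have "(c /\<^sub>R b) \<bullet> v \<le> 1" if "v \<in> V" for v
    using le[OF that] \<open>b > 0\<close> by (simp add: field_simps)
  moreover have "V \<inter> P = {v \<in> V. (c /\<^sub>R b) \<bullet> v = 1}"
    using \<open>b > 0\<close> Peq by (auto simp: field_simps hull_inc)
  ultimately show thesis
    using that by blast
qed

text \<open>In graph terms, span membership says that \<open>i\<close> and \<open>j\<close> are
  joined by edges from \<open>A\<close>, along which \<open>h\<close> changes by integers. A
  separating functional takes the place of an explicit path.\<close>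

lemma potential_difference_Ints:
  fixes h :: "real ^ 'n::finite" and A :: "(real ^ 'n) set"
  assumes span: "axis i 1 - axis j 1 \<in> span A"
    and A: "\<And>v. v \<in> A \<Longrightarrow> \<exists>k l. v = axis k 1 - axis l 1 \<and> h $ k - h $ l \<in> \<int>"
  shows "h $ i - h $ j \<in> \<int>"
proof -
  define S where "S = {k. h $ i - h $ k \<in> \<int>}"
  define f :: "real ^ 'n \<Rightarrow> real" where "f v = (\<Sum>k\<in>S. v $ k)" for v
  \<comment> \<open>The vectors in \<open>A\<close> never cross the boundary of \<open>S\<close>, so \<open>f\<close> vanishes on \<open>span A\<close>.\<close>
  have f_diff: "f (axis k 1 - axis l 1) = of_bool (k \<in> S) - of_bool (l \<in> S)" for k l
    by (simp add: f_def sum_subtractf axis_def of_bool_def)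
  have "linear f"
    by (rule linearI) (simp_all add: f_def sum.distrib sum_distrib_left)
  moreover have "f v = 0" if "v \<in> A" for v
  proof -
    obtain k l where v: "v = axis k 1 - axis l 1" and kl: "h $ k - h $ l \<in> \<int>"
      using A \<open>v \<in> A\<close> by blast
    have "h $ i - h $ l = (h $ i - h $ k) + (h $ k - h $ l)"
      and "h $ i - h $ k = (h $ i - h $ l) - (h $ k - h $ l)" by simp_all
    then have "k \<in> S \<longleftrightarrow> l \<in> S"
      unfolding S_def using kl by (metis Ints_add Ints_diff mem_Collect_eq)
    then show ?thesis by (simp add: v f_diff)
  qed
  ultimately have "f (axis i 1 - axis j 1) = 0"
    using linear_eq_0_on_span span by blast
  moreover have "i \<in> S" by (simp add: S_def)
  ultimately have "j \<in> S" by (simp add: f_diff split: if_splits)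
  then show ?thesis by (simp add: S_def)
qed

text \<open>Both memberships are expressed through the drop along the same arc
  \<open>(i, j)\<close>, so that an oriented cycle and its reversal can be compared arc by
  arc.\<close>

lemma nabla_facet_potential:
  assumes "nabla_facet G F"
  obtains h :: "'n::finite \<Rightarrow> real"
  where "\<And>i j. (i, j) \<in> parcs G \<Longrightarrow> h i - h j \<in> {-1, 0, 1}"
    and "\<And>i j. (i, j) \<in> parcs G \<Longrightarrow> (i, j) \<in> parcs (facet_digraph F) \<longleftrightarrow> h i - h j = 1"
    and "\<And>i j. (i, j) \<in> parcs G \<Longrightarrow> (j, i) \<in> parcs (facet_digraph F) \<longleftrightarrow> h i - h j = -1"
proof -
  obtain P where P: "P facet_of convex hull nabla G" and F: "F = nabla G \<inter> P"
    using assms by (auto simp: nabla_facet_def)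
  have range: "nabla G \<subseteq> range (\<lambda>(i, j). axis i 1 - axis j 1)"
    by (force simp: nabla_def image_iff)
  then have "finite (nabla G)"
    by (rule finite_subset) simp
  moreover have "- v \<in> nabla G" if "v \<in> nabla G" for v
    using that by (simp add: nabla_def) (metis minus_diff_eq)
  ultimately obtain a where le: "\<And>v. v \<in> nabla G \<Longrightarrow> a \<bullet> v \<le> 1"
    and Feq: "F = {v \<in> nabla G. a \<bullet> v = 1}" and span: "nabla G \<subseteq> span F"
    using facet_of_symmetric_hull[of "nabla G" P] P F by metis
  have a_diff: "a \<bullet> (axis i 1 - axis j 1) = a $ i - a $ j" for i j
    by (simp add: inner_diff_right inner_axis)
  have mem: "axis i 1 - axis j 1 \<in> nabla G" "axis j 1 - axis i 1 \<in> nabla G"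
    if "(i, j) \<in> parcs G" for i j
    using that by (auto simp: nabla_def)
  have F_diff: "\<exists>k l. v = axis k 1 - axis l 1 \<and> a $ k - a $ l \<in> \<int>" if v: "v \<in> F" for v
  proof -
    obtain k l where kl: "v = axis k 1 - axis l 1"
      using v Feq range by auto
    then have "a $ k - a $ l = 1"
      using v Feq a_diff by auto
    with kl show ?thesis by (metis Ints_1)
  qed
  show thesis
  proof (rule that[of "\<lambda>i. a $ i"])
    fix i j assume ij: "(i, j) \<in> parcs G"
    have "a $ i - a $ j \<in> \<int>"
      using potential_difference_Ints[OF _ F_diff] span mem[OF ij] by blast
    then obtain z where z: "a $ i - a $ j = of_int z"
      by (auto elim: Ints_cases)
    have "\<bar>a $ i - a $ j\<bar> \<le> 1"
      using le[OF mem(1)[OF ij]] le[OF mem(2)[OF ij]] by (simp add: a_diff)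
    then have "\<bar>z\<bar> \<le> 1" unfolding z by linarith
    then have "z = -1 \<or> z = 0 \<or> z = 1" by linarith
    then show "a $ i - a $ j \<in> {-1, 0, 1}" using z by auto
    show "(i, j) \<in> parcs (facet_digraph F) \<longleftrightarrow> a $ i - a $ j = 1"
      using mem[OF ij] by (simp add: facet_digraph_def Feq a_diff)
    show "(j, i) \<in> parcs (facet_digraph F) \<longleftrightarrow> a $ i - a $ j = -1"
      using mem[OF ij] by (auto simp: facet_digraph_def Feq a_diff)
  qed
qed

section \<open>Arcs of closed walks and of coherently oriented cycles\<close>

lemma cas_with_proj_nth:
  assumes "pre_digraph.cas (with_proj G) u p v" "i < length p"
  shows "fst (p ! i) = (if i = 0 then u else snd (p ! (i - 1)))"
  using assms
proof (induction p arbitrary: u i)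
  case (Cons e p)
  then have "pre_digraph.cas (with_proj G) (snd e) p v"
    by (simp add: pre_digraph.cas.simps)
  with Cons show ?case
    by (cases i) (auto simp: pre_digraph.cas.simps nth_Cons')
qed simp

lemma cas_with_proj_last:
  assumes "pre_digraph.cas (with_proj G) u p v" "p \<noteq> []"
  shows "snd (last p) = v"
  using assms by (induction p arbitrary: u) (auto simp: pre_digraph.cas.simps)

text \<open>The definition of \<open>cycle\<close> makes the heads distinct; the list of tails is
  the list of heads rotated by one place, which transfers distinctness to the tails.\<close>

lemma cycle_with_proj_arcs:
  assumes "pre_digraph.cycle (with_proj G) p"
  shows "set p \<subseteq> parcs G" and "inj_on snd (set p)" and "fst ` set p = snd ` set p"
    and "3 \<le> length p \<Longrightarrow> set p \<inter> (set p)\<inverse> = {}"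
proof -
  obtain u where walk: "pre_digraph.awalk (with_proj G) u p u" and "p \<noteq> []"
    and dist: "distinct (tl (pre_digraph.awalk_verts (with_proj G) u p))"
    using assms by (auto simp: pre_digraph.cycle_def)
  have cas: "pre_digraph.cas (with_proj G) u p u"
    using walk by (simp add: pre_digraph.awalk_def)
  show "set p \<subseteq> parcs G"
    using walk by (simp add: pre_digraph.awalk_def)
  have dsnd: "distinct (map snd p)"
    using dist \<open>p \<noteq> []\<close> pre_digraph.awalk_verts_conv'[OF cas] by simp
  then show "inj_on snd (set p)"
    by (simp add: distinct_map)
  have rot: "map fst p = u # butlast (map snd p)"
  proof (rule nth_equalityI)
    show "length (map fst p) = length (u # butlast (map snd p))"
      using \<open>p \<noteq> []\<close> by simp
  next
    fix i assume "i < length (map fst p)"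
    then show "map fst p ! i = (u # butlast (map snd p)) ! i"
      using cas_with_proj_nth[OF cas, of i] by (auto simp: nth_Cons' nth_butlast)
  qed
  have snoc: "map snd p = butlast (map snd p) @ [u]"
    using cas_with_proj_last[OF cas \<open>p \<noteq> []\<close>] \<open>p \<noteq> []\<close>
      append_butlast_last_id[of "map snd p"] by (simp add: last_map)
  have "set (map fst p) = set (map snd p)"
    by (subst rot, subst snoc) auto
  then show "fst ` set p = snd ` set p" by simp
  have dfst: "distinct (map fst p)"
    using dsnd rot snoc by (metis distinct1_rotate rotate1.simps(2))
  have eq_fst: "i = j" if "fst (p ! i) = fst (p ! j)" "i < length p" "j < length p" for i j
    using that dfst by (simp add: distinct_conv_nth) metis
  \<comment> \<open>Indices are cyclic: the last arc is followed by the first.\<close>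
  have snd_nth: "snd (p ! i) = fst (p ! (Suc i mod length p))" if "i < length p" for i
  proof (cases "Suc i < length p")
    case True
    then show ?thesis using cas_with_proj_nth[OF cas, of "Suc i"] by simp
  next
    case False
    then have "Suc i = length p" using that by simp
    then show ?thesis
      using cas_with_proj_last[OF cas \<open>p \<noteq> []\<close>] cas_with_proj_nth[OF cas, of 0] \<open>p \<noteq> []\<close>
      by (simp add: last_conv_nth flip: \<open>Suc i = length p\<close>)
  qed
  show "set p \<inter> (set p)\<inverse> = {}" if "3 \<le> length p"
  proof (rule ccontr)
    let ?n = "length p"
    assume "set p \<inter> (set p)\<inverse> \<noteq> {}"
    then obtain x y where "(x, y) \<in> set p" "(y, x) \<in> set p" by auto
    then obtain i j where ij: "i < ?n" "p ! i = (x, y)" "j < ?n" "p ! j = (y, x)"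
      by (auto simp: in_set_conv_nth)
    \<comment> \<open>An arc and its reverse would follow each other cyclically, so two steps would
      lead back to the start, which is impossible with at least 3 arcs.\<close>
    have "Suc i mod ?n = j" "Suc j mod ?n = i"
      using ij snd_nth[of i] snd_nth[of j] \<open>p \<noteq> []\<close> by (auto intro!: eq_fst)
    then show False
      using ij(1,3) that by (auto simp: mod_Suc split: if_splits)
  qed
qed

text \<open>By counting, \<open>D\<close> has as many arcs as the cycle has vertices, so the
  injective maps \<open>fst\<close> and \<open>snd\<close> both hit every vertex. It is not
  necessary to identify \<open>D\<close> with the walk or its reversal.\<close>

lemma coherent_orientation_fst_eq_snd:
  assumes C: "undirected_cycle G C" and D: "coherent_orientation D C"
  shows "fst ` parcs D = snd ` parcs D"
proof -
  obtain p where cyc: "pre_digraph.cycle (with_proj G) p" and "3 \<le> length p"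
    and parcs: "parcs C = set p \<union> (set p)\<inverse>"
    using C by (auto simp: undirected_cycle_def)
  let ?V = "snd ` set p"
  have un: "parcs D \<union> (parcs D)\<inverse> = parcs C" and disj: "parcs D \<inter> (parcs D)\<inverse> = {}"
    and inj: "inj_on fst (parcs D)" "inj_on snd (parcs D)"
    using D by (auto simp: coherent_orientation_def orientation_of_def)
  have double: "card (A \<union> A\<inverse>) = 2 * card A" if "finite A" "A \<inter> A\<inverse> = {}" for A :: "('a \<times> 'a) set"
    using that by (simp add: card_Un_disjoint)
  have fin: "finite (parcs D)"
    using un parcs finite_subset[of "parcs D" "parcs C"] by auto
  \<comment> \<open>Both \<open>D\<close> and the walk select exactly one of the two arcs of each
    edge of \<open>C\<close>.\<close>
  have "2 * card (parcs D) = 2 * card (set p)"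
    using double[OF fin disj] double[of "set p"] cycle_with_proj_arcs(4)[OF cyc] \<open>3 \<le> length p\<close>
      un parcs by simp
  then have card: "card (parcs D) = card ?V"
    using cycle_with_proj_arcs(2)[OF cyc] by (simp add: card_image)
  have "set p \<subseteq> ?V \<times> ?V"
    using subset_fst_snd[of "set p"] cycle_with_proj_arcs(3)[OF cyc] by simp
  then have sub: "parcs D \<subseteq> ?V \<times> ?V"
    using un parcs by blast
  have "fst ` parcs D = ?V"
    by (rule card_subset_eq) (use sub card inj in \<open>auto simp: card_image\<close>)
  moreover have "snd ` parcs D = ?V"
    by (rule card_subset_eq) (use sub card inj in \<open>auto simp: card_image\<close>)
  ultimately show ?thesis by simp
qed

text \<open>Each value is the indicator of 1 minus the indicator of -1, so the sum is the difference
  of the two cardinalities.\<close>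

lemma sum_signs_zero_card_eq:
  fixes d :: "'a \<Rightarrow> real"
  assumes "finite A" "\<And>x. x \<in> A \<Longrightarrow> d x \<in> {-1, 0, 1}" "sum d A = 0"
  shows "card {x \<in> A. d x = 1} = card {x \<in> A. d x = -1}"
proof -
  have "sum d A = (\<Sum>x\<in>A. of_bool (d x = 1) - of_bool (d x = -1))"
    by (rule sum.cong) (use assms(2) in fastforce)+
  also have "\<dots> = real (card {x \<in> A. d x = 1}) - real (card {x \<in> A. d x = -1})"
    using assms(1) by (simp add: sum_subtractf Int_def)
  finally show ?thesis using assms(3) by simp
qed

theorem mainTheorem4:
  fixes G :: "'n::finite pair_pre_digraph" and F :: "(real ^ 'n) set"
    and C D :: "'n pair_pre_digraph"
  assumes "pair_graph G" and "pverts G = UNIV"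
    and "Digraph_Component.connected (with_proj G)" and "parcs G \<noteq> {}"
    and "nabla_facet G F"
    and "undirected_cycle G C" and "coherent_orientation D C"
  shows "card (parcs (facet_digraph F) \<inter> parcs D) =
         card (parcs (facet_digraph F) \<inter> parcs (reverse_digraph D))"
proof -
  obtain h :: "'n \<Rightarrow> real"
    where h: "\<And>i j. (i, j) \<in> parcs G \<Longrightarrow> h i - h j \<in> {-1, 0, 1}"
    and fwd: "\<And>i j. (i, j) \<in> parcs G \<Longrightarrow> (i, j) \<in> parcs (facet_digraph F) \<longleftrightarrow> h i - h j = 1"
    and bwd: "\<And>i j. (i, j) \<in> parcs G \<Longrightarrow> (j, i) \<in> parcs (facet_digraph F) \<longleftrightarrow> h i - h j = -1"
    using nabla_facet_potential[OF assms(5)] by metis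
  have "sym (parcs G)"
    using pair_sym_digraph.pair_sym_arcs[of G] assms(1)
    by (simp add: pair_graph_def pair_pseudo_graph_def symmetric_def)
  moreover obtain p where "pre_digraph.cycle (with_proj G) p" "parcs C = set p \<union> (set p)\<inverse>"
    using assms(6) by (auto simp: undirected_cycle_def)
  ultimately have "parcs C \<subseteq> parcs G"
    using cycle_with_proj_arcs(1)[of G p] by (auto dest: symD)
  then have sub: "parcs D \<subseteq> parcs G"
    using assms(7) by (auto simp: coherent_orientation_def orientation_of_def)
  let ?d = "\<lambda>e. h (fst e) - h (snd e)"
  have d: "?d e \<in> {-1, 0, 1}" if "e \<in> parcs D" for e
    using h[of "fst e" "snd e"] sub that by (metis prod.collapse subsetD)
  \<comment> \<open>Coherence makes \<open>fst\<close> and \<open>snd\<close> injective on the arcs,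
    which turns the telescoping into two sums over vertices.\<close>
  have "sum ?d (parcs D) = sum h (fst ` parcs D) - sum h (snd ` parcs D)"
    using assms(7) by (simp add: coherent_orientation_def sum_subtractf sum.reindex)
  also have "\<dots> = 0"
    using coherent_orientation_fst_eq_snd[OF assms(6,7)] by simp
  finally have "card {e \<in> parcs D. ?d e = 1} = card {e \<in> parcs D. ?d e = -1}"
    using d by (intro sum_signs_zero_card_eq) simp_all
  moreover have "parcs (facet_digraph F) \<inter> parcs D = {e \<in> parcs D. ?d e = 1}"
    using fwd sub by auto
  \<comment> \<open>Reversed arcs in the facet digraph are counted by their originals in
    \<open>D\<close>, since taking the converse preserves cardinality.\<close>
  moreover have "parcs (facet_digraph F) \<inter> parcs (reverse_digraph D) = {e \<in> parcs D. ?d e = -1}\<inverse>"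
    using bwd sub by (auto simp: reverse_digraph_def)
  ultimately show ?thesis
    by simp
qed

end
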